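(* Suppose $\det(\nu_{i+j,n})_{i,j=0}^{n}\neq0$ for all $n\ge0$. Let $\Delta''_n=\det(\nu_{i+j,j})_{0\le i,j\le n}$ and $\Delta'''_n=\det(\nu_{i,j})_{0\le i,j\le n}$. If moreover $\lambda_k\neq0$ for all $k$, then \[ Q_n(x)=\frac{1}{\Delta''_n}\det\begin{pmatrix}(\nu_{i+j,j})_{0\le i\le n-1,\ 0\le j\le n}\\ \left(\frac{x^j}{d_j(x)}\right)_{0\le j\le n}\end{pmatrix}. \] Also, \[ Q_n(x)=\frac{1}{\Delta'''_n}\det\begin{pmatrix}(\nu_{i,j})_{0\le i\le n-1,\ 0\le j\le n}\\ \left(\frac{1}{d_j(x)}\right)_{0\le j\le n}\end{pmatrix}. \]
   Context: Let $\{b_n\}_{n\ge0},\{a_n\}_{n\ge0},\{\lambda_n\}_{n\ge0}$ be sequences of complex numbers. Define monic polynomials $P_n(x)$ by $P_{-1}(x)=0$, $P_0(x)=1$ and $P_{n+1}(x)=(x-b_n)P_n(x)-(a_nx+\lambda_n)P_{n-1}(x)$ for $n\ge0$. Let $d_0(x)=1$, $d_m(x)=\prod_{i=1}^m(a_ix+\lambda_i)$, and $Q_m(x)=P_m(x)/d_m(x)$. Assume $a_n\neq0$ and $P_n(-\lambda_n/a_n)\neq 0$ for all $n\ge1$. Let $V=\mathrm{span}\{x^nQ_m(x):n,m\ge0\}$ (rational functions; it contains every $x^n/d_m(x)$), and let $\mathcal{L}$ be the unique linear functional on $V$ with $\mathcal{L}(1)=1$ and $\mathcal{L}(x^nQ_m(x))=0$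 whenever $0\le n<m$. Set $\nu_{n,m}=\mathcal{L}(x^n/d_m(x))$. In each determinant, the first $n$ rows are indexed by $i=0,\dots,n-1$ and the last row is the displayed row of functions. *)

theory Defs
  imports "Jordan_Normal_Form.Determinant"
begin

type_synonym ratfun = "complex poly fract"

abbreviation ratconst :: "complex \<Rightarrow> ratfun" where
  "ratconst c \<equiv> to_fract [:c:]"

abbreviation ratX :: ratfun where
  "ratX \<equiv> to_fract [:0, 1:]"

definition ratscale :: "complex \<Rightarrow> ratfun \<Rightarrow> ratfun" where
  "ratscale c f = ratconst c * f"

lemma ratconst_add: "ratconst (c + d) = ratconst c + ratconst d"
  by (simp flip: to_fract_add)

lemma ratconst_mult: "ratconst (c * d) = ratconst c * ratconst d"
  by (simp flip: to_fract_mult)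

lemma vector_space_ratscale: "vector_space ratscale"
  by unfold_locales
    (simp_all add: ratscale_def ratconst_add ratconst_mult algebra_simps flip: one_pCons)

interpretation ratfun: vector_space ratscale
  by (rule vector_space_ratscale)

text \<open>
  The monic polynomials of type \<open>R\<^sub>I\<close>.  The second equation is the recurrence at \<open>n = 0\<close> with
  \<open>P\<^sub>-\<^sub>1 = 0\<close>, so \<open>a 0\<close> and \<open>lam 0\<close> do not enter.
\<close>
fun RI_P :: "(nat \<Rightarrow> complex) \<Rightarrow> (nat \<Rightarrow> complex) \<Rightarrow> (nat \<Rightarrow> complex) \<Rightarrow> nat \<Rightarrow> complex poly" where
  "RI_P b a lam 0 = 1"
| "RI_P b a lam (Suc 0) = [:- b 0, 1:]"
| "RI_P b a lam (Suc (Suc n)) =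
     [:- b (Suc n), 1:] * RI_P b a lam (Suc n) - [:lam (Suc n), a (Suc n):] * RI_P b a lam n"

definition RI_d :: "(nat \<Rightarrow> complex) \<Rightarrow> (nat \<Rightarrow> complex) \<Rightarrow> nat \<Rightarrow> complex poly" where
  "RI_d a lam m = (\<Prod>i = 1..m. [:lam i, a i:])"

definition RI_Q :: "(nat \<Rightarrow> complex) \<Rightarrow> (nat \<Rightarrow> complex) \<Rightarrow> (nat \<Rightarrow> complex) \<Rightarrow> nat \<Rightarrow> ratfun" where
  "RI_Q b a lam m = to_fract (RI_P b a lam m) / to_fract (RI_d a lam m)"

definition RI_V :: "(nat \<Rightarrow> complex) \<Rightarrow> (nat \<Rightarrow> complex) \<Rightarrow> (nat \<Rightarrow> complex) \<Rightarrow> ratfun set" where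
  "RI_V b a lam = ratfun.span {ratX ^ n * RI_Q b a lam m | n m. True}"

text \<open>
  A linear functional on \<open>V\<close> is a function on all rational functions of which only the
  restriction to \<open>V\<close> is constrained.
\<close>
definition linear_functional_on :: "ratfun set \<Rightarrow> (ratfun \<Rightarrow> complex) \<Rightarrow> bool" where
  "linear_functional_on V L \<longleftrightarrow>
     (\<forall>f\<in>V. \<forall>g\<in>V. L (f + g) = L f + L g) \<and> (\<forall>c. \<forall>f\<in>V. L (ratscale c f) = c * L f)"

definition RI_functional ::
  "(nat \<Rightarrow> complex) \<Rightarrow> (nat \<Rightarrow> complex) \<Rightarrow> (nat \<Rightarrow> complex) \<Rightarrow> (ratfun \<Rightarrow> complex) \<Rightarrow> bool" where
  "RI_functional b a lam L \<longleftrightarrow>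
     linear_functional_on (RI_V b a lam) L \<and> L 1 = 1 \<and>
     (\<forall>n m. n < m \<longrightarrow> L (ratX ^ n * RI_Q b a lam m) = 0)"

definition RI_nu ::
  "(nat \<Rightarrow> complex) \<Rightarrow> (nat \<Rightarrow> complex) \<Rightarrow> (ratfun \<Rightarrow> complex) \<Rightarrow> nat \<Rightarrow> nat \<Rightarrow> complex" where
  "RI_nu a lam L n m = L (ratX ^ n / to_fract (RI_d a lam m))"

definition RI_Delta2 ::
  "(nat \<Rightarrow> complex) \<Rightarrow> (nat \<Rightarrow> complex) \<Rightarrow> (ratfun \<Rightarrow> complex) \<Rightarrow> nat \<Rightarrow> complex" where
  "RI_Delta2 a lam L n = det (mat (n + 1) (n + 1) (\<lambda>(i, j). RI_nu a lam L (i + j) j))"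

definition RI_Delta3 ::
  "(nat \<Rightarrow> complex) \<Rightarrow> (nat \<Rightarrow> complex) \<Rightarrow> (ratfun \<Rightarrow> complex) \<Rightarrow> nat \<Rightarrow> complex" where
  "RI_Delta3 a lam L n = det (mat (n + 1) (n + 1) (\<lambda>(i, j). RI_nu a lam L i j))"

end

theory Submission
  imports Defs
begin

text \<open>
  Let \<open>w\<^sub>j\<close> be polynomials of degree at most \<open>j\<close> that do not vanish at the root of
  \<open>a\<^sub>jx + \<lambda>\<^sub>j\<close>.  Splitting off one linear factor at a time expands every \<open>p/d\<^sub>n\<close> with
  \<open>deg p \<le> n\<close> in the functions \<open>u\<^sub>j = w\<^sub>j/d\<^sub>j\<close>, \<open>j \<le> n\<close>.  For \<open>w\<^sub>j = P\<^sub>j\<close> this shows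
  \<open>p/d\<^sub>n \<in> V\<close>; the two formulas are the cases \<open>w\<^sub>j = x\<^sup>j\<close> (hence \<open>\<lambda>\<^sub>j \<noteq> 0\<close>) and \<open>w\<^sub>j = 1\<close> of one
  statement.  Namely, write \<open>Q\<^sub>n = \<Sum>\<^sub>j c\<^sub>j u\<^sub>j\<close>.  The recurrence gives \<open>L (x\<^sup>i Q\<^sub>n) = \<delta>\<^sub>i\<^sub>n\<close> for
  \<open>i \<le> n\<close>, so the matrix \<open>M = (L (x\<^sup>i u\<^sub>j))\<close> maps \<open>c\<close> to the last unit vector, and by Cramer's
  rule replacing the last row of \<open>M\<close> by \<open>(u\<^sub>j)\<close> multiplies its determinant by \<open>Q\<^sub>n\<close>.  Expanding
  the functions \<open>x\<^sup>k/d\<^sub>n\<close> in the \<open>u\<^sub>j\<close> factors the matrix \<open>(\<nu>\<^sub>i\<^sub>+\<^sub>k\<^sub>,\<^sub>n)\<close> through \<open>M\<close>, whence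
  \<open>det M \<noteq> 0\<close>.
\<close>

section \<open>Cramer's rule for rows\<close>

definition replace_row :: "'a mat \<Rightarrow> 'a vec \<Rightarrow> nat \<Rightarrow> 'a mat" where
  "replace_row A s k =
    mat (dim_row A) (dim_col A) (\<lambda>(i, j). if i = k then s $ j else A $$ (i, j))"

lemma cofactor_replace_row: "cofactor (replace_row A s k) k j = cofactor A k j"
proof -
  have "mat_delete (replace_row A s k) k j = mat_delete A k j"
    by (rule eq_matI) (auto simp: mat_delete_def replace_row_def)
  then show ?thesis
    by (simp add: cofactor_def)
qed

lemma cofactor_eq_solution_mult_det:
  fixes A :: "'a :: comm_ring_1 mat"
  assumes carrier: "A \<in> carrier_mat n n" "c \<in> carrier_vec n"
    and solution: "A *\<^sub>v c = unit_vec n k" and less: "k < n" "j < n"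
  shows "cofactor A k j = c $ j * det A"
proof -
  have "cofactor A k j = (adj_mat A *\<^sub>v (A *\<^sub>v c)) $ j"
    using carrier(1) less by (simp add: solution adj_mat_def)
  also have "adj_mat A *\<^sub>v (A *\<^sub>v c) = (adj_mat A * A) *\<^sub>v c"
    using adj_mat(1)[OF carrier(1)] carrier by simp
  also have "\<dots> $ j = c $ j * det A"
    using carrier(2) less by (simp add: adj_mat(3)[OF carrier(1)] mult.commute)
  finally show ?thesis .
qed

lemma det_replace_row:
  fixes A :: "'a :: comm_ring_1 mat"
  assumes carrier: "A \<in> carrier_mat n n" "c \<in> carrier_vec n"
    and solution: "A *\<^sub>v c = unit_vec n k" and less: "k < n"
  shows "det (replace_row A s k) = (s \<bullet> c) * det A"
proof -
  let ?B = "replace_row A s k"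
  have "det ?B = (\<Sum>j<n. ?B $$ (k, j) * cofactor ?B k j)"
    using carrier less by (intro laplace_expansion_row) (auto simp: replace_row_def)
  also have "\<dots> = (\<Sum>j<n. s $ j * (c $ j * det A))"
  proof (rule sum.cong)
    fix j assume "j \<in> {..<n}"
    then have "cofactor ?B k j = c $ j * det A"
      using less
      by (simp add: cofactor_replace_row cofactor_eq_solution_mult_det[OF carrier solution])
    moreover have "?B $$ (k, j) = s $ j"
      using \<open>j \<in> {..<n}\<close> carrier less by (simp add: replace_row_def)
    ultimately show "?B $$ (k, j) * cofactor ?B k j = s $ j * (c $ j * det A)"
      by simp
  qed simp
  also have "\<dots> = (s \<bullet> c) * det A"
    using carrier by (simp add: scalar_prod_def sum_distrib_right mult.assoc atLeast0LessThan)
  finally show ?thesis .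
qed

section \<open>Polynomials as rational functions\<close>

lemma linear_poly_dvd_iff:
  fixes c0 c1 :: "'a :: field"
  assumes "c1 \<noteq> 0"
  shows "[:c0, c1:] dvd p \<longleftrightarrow> poly p (- c0 / c1) = 0"
proof -
  have "[:c0, c1:] = smult c1 [:- (- c0 / c1), 1:]"
    using assms by simp
  then show ?thesis
    using assms by (simp only: smult_dvd_iff poly_eq_0_iff_dvd) simp
qed

lemma to_fract_power: "to_fract (p ^ n) = to_fract p ^ n"
  by (induction n) simp_all

lemma to_fract_smult: "to_fract (smult c p) = ratscale c (to_fract p)"
  by (simp add: ratscale_def flip: to_fract_mult)

lemma to_fract_monom: "to_fract (monom c k) = ratscale c (ratX ^ k)"
  by (simp add: monom_altdef to_fract_smult to_fract_power)

lemma to_fract_mult_eq_sum: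
  "to_fract p * f = (\<Sum>k\<le>degree p. ratscale (coeff p k) (ratX ^ k * f))"
proof -
  have "to_fract (\<Sum>k\<in>A. q k) = (\<Sum>k\<in>A. to_fract (q k))" for q :: "nat \<Rightarrow> complex poly" and A
    by (induction A rule: infinite_finite_induct) simp_all
  then have "to_fract p = (\<Sum>k\<le>degree p. to_fract (monom (coeff p k) k))"
    by (metis poly_as_sum_of_monoms)
  then show ?thesis
    by (simp add: to_fract_monom ratscale_def sum_distrib_right mult.assoc)
qed

lemma comm_ring_hom_ratconst: "comm_ring_hom (\<lambda>c. ratconst c)"
  by unfold_locales (simp_all add: ratconst_add ratconst_mult flip: one_pCons)

lemma det_ratconst_last_row:
  assumes solution: "\<And>i. i \<le> n \<Longrightarrow> (\<Sum>j\<le>n. c j * M i j) = (if i = n then 1 else 0)"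
  shows "det (mat (n + 1) (n + 1) (\<lambda>(i, j). if i < n then ratconst (M i j) else u j)) =
    (\<Sum>j\<le>n. ratscale (c j) (u j)) * ratconst (det (mat (n + 1) (n + 1) (\<lambda>(i, j). M i j)))"
proof -
  interpret comm_ring_hom "\<lambda>c. ratconst c"
    by (rule comm_ring_hom_ratconst)
  let ?h = "\<lambda>c. ratconst c"
  define A where "A = mat (n + 1) (n + 1) (\<lambda>(i, j). M i j)"
  define v where "v = vec (n + 1) c"
  have carrier: "A \<in> carrier_mat (n + 1) (n + 1)" "v \<in> carrier_vec (n + 1)"
    by (simp_all add: A_def v_def)
  have "A *\<^sub>v v = unit_vec (n + 1) n"
    by (rule eq_vecI)
      (auto simp: A_def v_def scalar_prod_def atLeast0LessThan lessThan_Suc_atMost mult.commute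
        solution simp flip: solution)
  then have "map_mat ?h A *\<^sub>v map_vec ?h v = map_vec ?h (unit_vec (n + 1) n)"
    using mult_mat_vec_hom[OF carrier] by (simp only:)
  also have "\<dots> = unit_vec (n + 1) n"
    by (rule eq_vecI) (auto simp: unit_vec_def)
  finally have "det (replace_row (map_mat ?h A) (vec (n + 1) u) n) =
      (vec (n + 1) u \<bullet> map_vec ?h v) * det (map_mat ?h A)"
    using carrier by (intro det_replace_row[where n = "n + 1"]) auto
  moreover have "mat (n + 1) (n + 1) (\<lambda>(i, j). if i < n then ratconst (M i j) else u j) =
      replace_row (map_mat ?h A) (vec (n + 1) u) n"
    by (rule eq_matI) (auto simp: A_def replace_row_def)
  moreover have "vec (n + 1) u \<bullet> map_vec ?h v = (\<Sum>j\<le>n. ratscale (c j) (u j))"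
    by (simp add: v_def scalar_prod_def ratscale_def atLeast0LessThan lessThan_Suc_atMost
        mult.commute)
  ultimately show ?thesis
    by (simp add: A_def)
qed

lemma linear_functional_on_sum:
  assumes subspace: "ratfun.subspace V" and linear: "linear_functional_on V L"
    and "\<And>k. k \<in> A \<Longrightarrow> f k \<in> V"
  shows "L (\<Sum>k\<in>A. ratscale (c k) (f k)) = (\<Sum>k\<in>A. c k * L (f k))"
proof -
  have "L (ratscale 0 0) = 0 * L 0"
    using linear ratfun.subspace_0[OF subspace] unfolding linear_functional_on_def by blast
  then have L_0: "L 0 = 0" by simp
  from assms(3) show ?thesis
  proof (induction A rule: infinite_finite_induct)
    case (insert x A)
    then have "ratscale (c x) (f x) \<in> V" "(\<Sum>k\<in>A. ratscale (c k) (f k)) \<in> V"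
      using subspace by (auto intro: ratfun.subspace_scale ratfun.subspace_sum)
    with insert linear show ?case
      by (simp add: linear_functional_on_def)
  qed (simp_all add: L_0)
qed

section \<open>Expansions with successive linear denominators\<close>

lemma RI_d_0: "RI_d a lam 0 = 1"
  by (simp add: RI_d_def)

lemma RI_d_Suc: "RI_d a lam (Suc m) = [:lam (Suc m), a (Suc m):] * RI_d a lam m"
  by (simp add: RI_d_def mult.commute)

locale RI_denominators =
  fixes a lam :: "nat \<Rightarrow> complex"
  assumes a_nonzero: "n \<ge> 1 \<Longrightarrow> a n \<noteq> 0"
begin

abbreviation d :: "nat \<Rightarrow> ratfun" where "d m \<equiv> to_fract (RI_d a lam m)"

definition numerators :: "(nat \<Rightarrow> complex poly) \<Rightarrow> bool" where
  "numerators w \<longleftrightarrow> w 0 \<noteq> 0 \<and> (\<forall>j. degree (w j) \<le> j) \<and>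
    (\<forall>j\<ge>1. poly (w j) (- lam j / a j) \<noteq> 0)"

lemma d_nonzero: "d m \<noteq> 0"
  using a_nonzero by (auto simp: RI_d_def)

lemma d_Suc: "d (Suc m) = to_fract [:lam (Suc m), a (Suc m):] * d m"
  by (simp only: RI_d_Suc to_fract_mult)

lemma linear_factor_nonzero: "[:lam (Suc m), a (Suc m):] \<noteq> 0"
  using a_nonzero[of "Suc m"] by simp

lemma linear_factor_mult_frac_d_Suc:
  "to_fract ([:lam (Suc m), a (Suc m):] * q) / d (Suc m) = to_fract q / d m"
  unfolding d_Suc to_fract_mult using linear_factor_nonzero[of m] d_nonzero[of m]
  by (intro mult_divide_mult_cancel_left) (simp only: to_fract_eq_0_iff not_False_eq_True)

lemma degree_le_of_linear_factor_mult:
  assumes "degree ([:lam (Suc m), a (Suc m):] * q) \<le> Suc n"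
  shows "degree q \<le> n"
proof (cases "q = 0")
  case False
  have "degree ([:lam (Suc m), a (Suc m):] * q) = Suc (degree q)"
    using False linear_factor_nonzero[of m] a_nonzero[of "Suc m"] by (subst degree_mult_eq) auto
  with assms show ?thesis by simp
qed simp

lemma frac_d_Suc_split:
  assumes "degree p \<le> Suc n" and "degree v \<le> Suc n"
    and v_nonzero: "poly v (- lam (Suc n) / a (Suc n)) \<noteq> 0"
  obtains s q where "degree q \<le> n"
    and "to_fract p / d (Suc n) = ratscale s (to_fract v / d (Suc n)) + to_fract q / d n"
proof -
  let ?l = "[:lam (Suc n), a (Suc n):]"
  define r where "r = - lam (Suc n) / a (Suc n)"
  define s where "s = poly p r / poly v r"
  have "poly (p - smult s v) r = 0"
    using v_nonzero by (simp add: s_def r_def)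
  then have "?l dvd p - smult s v"
    using a_nonzero[of "Suc n"] unfolding r_def by (subst linear_poly_dvd_iff) auto
  then obtain q where quotient: "p - smult s v = ?l * q" ..
  have "degree (?l * q) \<le> Suc n"
    unfolding quotient[symmetric] using assms by (intro degree_diff_le) auto
  then have "degree q \<le> n"
    by (rule degree_le_of_linear_factor_mult)
  moreover have "to_fract p = to_fract (smult s v + ?l * q)"
    by (simp only: quotient[symmetric]) simp
  then have "to_fract p / d (Suc n) = to_fract (smult s v) / d (Suc n) + to_fract q / d n"
    by (simp only: to_fract_add add_divide_distrib linear_factor_mult_frac_d_Suc)
  then have "to_fract p / d (Suc n) = ratscale s (to_fract v / d (Suc n)) + to_fract q / d n"
    by (simp add: to_fract_smult ratscale_def)
  ultimately show thesis
    by (rule that)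
qed

lemma numerators_expansion:
  assumes numerators: "numerators w" and "degree p \<le> n"
  shows "\<exists>c. to_fract p / d n = (\<Sum>j\<le>n. ratscale (c j) (to_fract (w j) / d j))"
  using assms(2)
proof (induction n arbitrary: p)
  case 0
  have "w 0 \<noteq> 0" "degree (w 0) \<le> 0"
    using numerators by (auto simp: numerators_def)
  then obtain s where w_0: "w 0 = [:s:]" "s \<noteq> 0"
    by (auto elim: degree_eq_zeroE)
  obtain t where p_eq: "p = [:t:]"
    using 0 by (auto elim: degree_eq_zeroE)
  have "p = smult (t / s) (w 0)"
    using w_0 p_eq by simp
  then have "to_fract p = ratscale (t / s) (to_fract (w 0))"
    by (simp only: to_fract_smult)
  then show ?case
    by (intro exI[of _ "\<lambda>_. t / s"]) (simp add: RI_d_0)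
next
  case (Suc n)
  have "degree (w (Suc n)) \<le> Suc n" "poly (w (Suc n)) (- lam (Suc n) / a (Suc n)) \<noteq> 0"
    using numerators by (simp_all add: numerators_def)
  with Suc.prems obtain s q where "degree q \<le> n"
    and split: "to_fract p / d (Suc n) =
      ratscale s (to_fract (w (Suc n)) / d (Suc n)) + to_fract q / d n"
    by (rule frac_d_Suc_split)
  then obtain c where "to_fract q / d n = (\<Sum>j\<le>n. ratscale (c j) (to_fract (w j) / d j))"
    using Suc.IH by blast
  then have "to_fract p / d (Suc n) =
      (\<Sum>j\<le>Suc n. ratscale ((c(Suc n := s)) j) (to_fract (w j) / d j))"
    by (simp add: split add.commute)
  then show ?case by blast
qed

end

section \<open>Biorthogonality\<close>

lemma degree_RI_P_le: "degree (RI_P b a lam n) \<le> n"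
proof (induction n rule: induct_nat_012)
  case (ge2 n)
  have "degree ([:- b (Suc n), 1:] * RI_P b a lam (Suc n)) \<le> Suc (Suc n)"
    using ge2 by (intro order.trans[OF degree_mult_le]) simp
  moreover have "degree ([:lam (Suc n), a (Suc n):] * RI_P b a lam n) \<le> Suc (Suc n)"
    using ge2 by (intro order.trans[OF degree_mult_le]) (simp add: degree_pCons_eq_if)
  ultimately show ?case
    by (simp only: RI_P.simps) (rule degree_diff_le)
qed simp_all

locale RI_system = RI_denominators a lam for a lam +
  fixes b :: "nat \<Rightarrow> complex" and L :: "ratfun \<Rightarrow> complex"
  assumes P_nonzero: "n \<ge> 1 \<Longrightarrow> poly (RI_P b a lam n) (- lam n / a n) \<noteq> 0"
    and functional: "RI_functional b a lam L"
begin

abbreviation P :: "nat \<Rightarrow> complex poly" where "P \<equiv> RI_P b a lam"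
abbreviation Q :: "nat \<Rightarrow> ratfun" where "Q \<equiv> RI_Q b a lam"
abbreviation V :: "ratfun set" where "V \<equiv> RI_V b a lam"

lemma numerators_P: "numerators P"
  using P_nonzero by (simp add: numerators_def degree_RI_P_le)

lemma subspace_V: "ratfun.subspace V"
  by (simp add: RI_V_def ratfun.subspace_span)

lemma X_power_mult_Q_in_V: "ratX ^ n * Q m \<in> V"
  unfolding RI_V_def by (rule ratfun.span_base) blast

lemma poly_mult_Q_in_V: "to_fract p * Q m \<in> V"
  unfolding to_fract_mult_eq_sum
  by (intro ratfun.subspace_sum ratfun.subspace_scale subspace_V X_power_mult_Q_in_V)

lemma frac_in_V: "to_fract p / d m \<in> V"
proof -
  obtain c where "to_fract 1 / d m = (\<Sum>j\<le>m. ratscale (c j) (Q j))"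
    using numerators_expansion[OF numerators_P, of 1 m] by (auto simp: RI_Q_def)
  moreover have "to_fract p / d m = to_fract p * (to_fract 1 / d m)"
    by simp
  ultimately have "to_fract p / d m = to_fract p * (\<Sum>j\<le>m. ratscale (c j) (Q j))"
    by (simp only:)
  also have "\<dots> = (\<Sum>j\<le>m. ratscale (c j) (to_fract p * Q j))"
    by (simp add: ratscale_def sum_distrib_left mult.left_commute)
  also have "\<dots> \<in> V"
    by (intro ratfun.subspace_sum ratfun.subspace_scale subspace_V poly_mult_Q_in_V)
  finally show ?thesis .
qed

lemma linear_functional_on_V: "linear_functional_on V L"
  using functional by (simp add: RI_functional_def)

lemmas L_sum = linear_functional_on_sum[OF subspace_V linear_functional_on_V]

lemma L_add: "f \<in> V \<Longrightarrow> g \<in> V \<Longrightarrow> L (f + g) = L f + L g"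
  using linear_functional_on_V by (simp add: linear_functional_on_def)

lemma L_X_power_mult_Q: "i < n \<Longrightarrow> L (ratX ^ i * Q n) = 0"
  using functional by (simp add: RI_functional_def)

lemma L_poly_mult_Q:
  assumes "degree p < n"
  shows "L (to_fract p * Q n) = 0"
  unfolding to_fract_mult_eq_sum
  using assms by (subst L_sum) (auto simp: X_power_mult_Q_in_V L_X_power_mult_Q)

lemma X_mult_Q_Suc:
  "ratX * Q (Suc n) = Q n + to_fract [:b (Suc n):] * Q (Suc n) +
    to_fract [:lam (Suc (Suc n)), a (Suc (Suc n)):] * Q (Suc (Suc n))"
proof -
  let ?l = "\<lambda>n. [:lam (Suc n), a (Suc n):]"
  have "[:0, 1:] * P (Suc n) = [:b (Suc n):] * P (Suc n) + ?l n * P n + P (Suc (Suc n))"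
    by (simp add: algebra_simps)
  then have "to_fract ([:0, 1:] * P (Suc n)) / d (Suc n) =
      to_fract ([:b (Suc n):] * P (Suc n)) / d (Suc n) + to_fract (?l n * P n) / d (Suc n) +
      to_fract (P (Suc (Suc n))) / d (Suc n)"
    by (simp only: to_fract_add add_divide_distrib)
  moreover have "to_fract (P (Suc (Suc n))) / d (Suc n) = to_fract (?l (Suc n)) * Q (Suc (Suc n))"
    by (simp only: RI_Q_def times_divide_eq_right linear_factor_mult_frac_d_Suc flip: to_fract_mult)
  ultimately show ?thesis
    unfolding linear_factor_mult_frac_d_Suc
    by (simp only: RI_Q_def to_fract_mult times_divide_eq_right) simp
qed

lemma L_X_power_mult_Q_self: "L (ratX ^ n * Q n) = 1"
proof (induction n)
  case 0
  then show ?case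
    using functional by (simp add: RI_functional_def RI_Q_def RI_d_0)
next
  case (Suc n)
  let ?l = "[:lam (Suc (Suc n)), a (Suc (Suc n)):]"
  let ?p = "[:0, 1:] ^ n * [:b (Suc n):]" and ?q = "[:0, 1:] ^ n * ?l"
  have degree_X_power_mult: "degree ([:0, 1:] ^ n * r) \<le> n + degree r" for r :: "complex poly"
    using degree_mult_le[of "[:0, 1:] ^ n" r] by (simp only: degree_linear_power)
  have "degree ?p < Suc n" "degree ?q < Suc (Suc n)"
    by (rule le_less_trans[OF degree_X_power_mult]; simp)+
  then have vanish: "L (to_fract ?p * Q (Suc n)) = 0" "L (to_fract ?q * Q (Suc (Suc n))) = 0"
    by (simp_all only: L_poly_mult_Q)
  have "ratX ^ Suc n * Q (Suc n) = ratX ^ n * (ratX * Q (Suc n))"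
    by simp
  also have "\<dots> = ratX ^ n * Q n + to_fract ?p * Q (Suc n) + to_fract ?q * Q (Suc (Suc n))"
    unfolding X_mult_Q_Suc to_fract_mult to_fract_power by (simp only: distrib_left mult.assoc)
  also have "L \<dots> = L (ratX ^ n * Q n) + L (to_fract ?p * Q (Suc n)) +
      L (to_fract ?q * Q (Suc (Suc n)))"
    by (simp only: L_add ratfun.subspace_add[OF subspace_V] X_power_mult_Q_in_V poly_mult_Q_in_V)
  finally show ?case
    by (simp only: vanish Suc.IH add_0_right)
qed

section \<open>Determinant formulas for arbitrary numerators\<close>

definition moment_matrix :: "(nat \<Rightarrow> ratfun) \<Rightarrow> nat \<Rightarrow> complex mat" where
  "moment_matrix u n = mat (n + 1) (n + 1) (\<lambda>(i, j). L (ratX ^ i * u j))"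

lemma X_power_mult_frac_in_V: "ratX ^ i * (to_fract p / d m) \<in> V"
  using frac_in_V[of "[:0, 1:] ^ i * p" m] by (simp add: to_fract_power)

lemma L_X_power_mult_sum:
  assumes f_eq: "f = (\<Sum>j\<in>A. ratscale (c j) (to_fract (w j) / d j))"
  shows "L (ratX ^ i * f) = (\<Sum>j\<in>A. c j * L (ratX ^ i * (to_fract (w j) / d j)))"
proof -
  have "ratX ^ i * f = (\<Sum>j\<in>A. ratscale (c j) (ratX ^ i * (to_fract (w j) / d j)))"
    unfolding f_eq by (simp add: ratscale_def sum_distrib_left mult.left_commute)
  then show ?thesis
    by (simp only: L_sum[OF X_power_mult_frac_in_V])
qed

lemma det_moment_matrix_nonzero:
  assumes numerators: "numerators w" and moments: "det (moment_matrix (\<lambda>k. ratX ^ k / d n) n) \<noteq> 0"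
  shows "det (moment_matrix (\<lambda>j. to_fract (w j) / d j) n) \<noteq> 0"
proof -
  let ?M = "moment_matrix (\<lambda>j. to_fract (w j) / d j) n"
  have "\<exists>c. ratX ^ k / d n = (\<Sum>j\<le>n. ratscale (c j) (to_fract (w j) / d j))" if "k \<le> n" for k
    using that numerators_expansion[OF numerators, of "[:0, 1:] ^ k" n]
    by (auto simp: to_fract_power degree_linear_power)
  then obtain C where expansion: "ratX ^ k / d n = (\<Sum>j\<le>n. ratscale (C k j) (to_fract (w j) / d j))"
    if "k \<le> n" for k
    by metis
  let ?T = "mat (n + 1) (n + 1) (\<lambda>(j, k). C k j)"
  have "moment_matrix (\<lambda>k. ratX ^ k / d n) n = ?M * ?T"
  proof (rule eq_matI)
    fix i k assume "i < dim_row (?M * ?T)" "k < dim_col (?M * ?T)"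
    then have i_le: "i \<le> n" and k_le: "k \<le> n"
      by (auto simp: moment_matrix_def)
    have "(?M * ?T) $$ (i, k) = (\<Sum>j\<le>n. L (ratX ^ i * (to_fract (w j) / d j)) * C k j)"
      using i_le k_le
      by (simp add: moment_matrix_def scalar_prod_def atLeast0LessThan flip: lessThan_Suc_atMost)
    also have "\<dots> = L (ratX ^ i * (ratX ^ k / d n))"
      by (simp only: L_X_power_mult_sum[OF expansion[OF k_le]] mult.commute)
    finally show "moment_matrix (\<lambda>k. ratX ^ k / d n) n $$ (i, k) = (?M * ?T) $$ (i, k)"
      using i_le k_le by (simp add: moment_matrix_def)
  qed (simp_all add: moment_matrix_def)
  then have "det (moment_matrix (\<lambda>k. ratX ^ k / d n) n) = det ?M * det ?T"
    by (simp add: det_mult[of _ "n + 1"] moment_matrix_def)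
  with moments show ?thesis by auto
qed

lemma Q_eq_det:
  assumes numerators: "numerators w" and moments: "det (moment_matrix (\<lambda>k. ratX ^ k / d n) n) \<noteq> 0"
    and u_eq: "\<And>j. u j = to_fract (w j) / d j"
  shows "Q n = 1 / ratconst (det (moment_matrix u n)) *
    det (mat (n + 1) (n + 1) (\<lambda>(i, j). if i < n then ratconst (L (ratX ^ i * u j)) else u j))"
proof -
  obtain c where Q_eq: "Q n = (\<Sum>j\<le>n. ratscale (c j) (u j))"
    unfolding RI_Q_def u_eq using numerators_expansion[OF numerators degree_RI_P_le] ..
  have "(\<Sum>j\<le>n. c j * L (ratX ^ i * u j)) = L (ratX ^ i * Q n)" for i
    using L_X_power_mult_sum[OF Q_eq[unfolded u_eq], of i] by (simp add: u_eq)
  then have "(\<Sum>j\<le>n. c j * L (ratX ^ i * u j)) = (if i = n then 1 else 0)" if "i \<le> n" for i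
    using that by (simp add: L_X_power_mult_Q L_X_power_mult_Q_self)
  from det_ratconst_last_row[where M = "\<lambda>i j. L (ratX ^ i * u j)", OF this]
  have "det (mat (n + 1) (n + 1) (\<lambda>(i, j). if i < n then ratconst (L (ratX ^ i * u j)) else u j)) =
      Q n * ratconst (det (moment_matrix u n))"
    by (simp only: Q_eq moment_matrix_def)
  moreover have "det (moment_matrix u n) \<noteq> 0"
    unfolding u_eq[abs_def] by (rule det_moment_matrix_nonzero[OF numerators moments])
  ultimately show ?thesis by simp
qed

end

theorem theorem6p6:
  fixes b a lam :: "nat \<Rightarrow> complex" and L :: "ratfun \<Rightarrow> complex"
  assumes "\<forall>n\<ge>1. a n \<noteq> 0"
    and "\<forall>n\<ge>1. poly (RI_P b a lam n) (- lam n / a n) \<noteq> 0"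
    and "RI_functional b a lam L"
    and "\<forall>n. det (mat (n + 1) (n + 1) (\<lambda>(i, j). RI_nu a lam L (i + j) n)) \<noteq> 0"
  shows "((\<forall>k. lam k \<noteq> 0) \<longrightarrow>
           (\<forall>n. RI_Q b a lam n =
              1 / ratconst (RI_Delta2 a lam L n) *
              det (mat (n + 1) (n + 1) (\<lambda>(i, j).
                if i < n then ratconst (RI_nu a lam L (i + j) j)
                else ratX ^ j / to_fract (RI_d a lam j)))))
       \<and> (\<forall>n. RI_Q b a lam n =
              1 / ratconst (RI_Delta3 a lam L n) *
              det (mat (n + 1) (n + 1) (\<lambda>(i, j).
                if i < n then ratconst (RI_nu a lam L i j)
                else 1 / to_fract (RI_d a lam j))))"
proof -
  interpret RI_system a lam b L
    using assms by unfold_locales auto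
  have moments: "det (moment_matrix (\<lambda>k. ratX ^ k / d n) n) \<noteq> 0" for n
    using assms(4) by (simp add: moment_matrix_def RI_nu_def power_add)
  have powers: "numerators (\<lambda>j. [:0, 1:] ^ j)" if "\<forall>k. lam k \<noteq> 0"
    using that a_nonzero by (simp add: numerators_def degree_linear_power poly_power)
  have ones: "numerators (\<lambda>_. 1)"
    by (simp add: numerators_def)
  show ?thesis
    using Q_eq_det[OF powers moments, of "\<lambda>j. ratX ^ j / d j"]
      Q_eq_det[OF ones moments, of "\<lambda>j. 1 / d j"]
    by (simp add: RI_Delta2_def RI_Delta3_def RI_nu_def moment_matrix_def power_add to_fract_power
        cong: if_cong)
qed

end
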